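(* Let $P,Q$ be real numbers with $P>0$, $Q\neq 0$ and $D := P^2-4Q > 0$, let $\alpha = (P+\sqrt{D})/2$, and let $U_n = U_n(P,Q)$, $V_n = V_n(P,Q)$ be the Lucas sequences. (i) If $Q>0$ and $k$ is a positive integer, then \[ \sum_{n=1}^{\infty}\mathcal{L}\left(\frac{U_k^2\, Q^{kn}}{U_{k(n+1)}^2}\right) = \mathcal{L}\left(\frac{Q^k}{\alpha^{2k}}\right). \] (ii) If $Q<0$ and $k$ is an odd positive integer, then \[ \sum_{n=1}^{\infty}\mathcal{L}\left(-\frac{V_k^2\, Q^{k(2n-1)}}{D\, U_{2kn}^2}\right) + \sum_{n=1}^{\infty}\mathcal{L}\left(\frac{V_k^2\, Q^{2kn}}{V_{k(2n+1)}^2}\right) = \mathcal{L}\left(-\frac{Q^k}{\alpha^{2k}}\right). \]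
   Context: $\mathcal{L}$ denotes the Rogers dilogarithm: for $0<x<1$, $\mathcal{L}(x) = \mathrm{Li}_2(x) + \frac{1}{2}\log(x)\log(1-x)$, where $\mathrm{Li}_2(x)=\sum_{n\ge1} x^n/n^2$; it is extended to $[0,1]$ by $\mathcal{L}(0)=0$ and $\mathcal{L}(1)=\pi^2/6$. The Lucas sequences are defined by $U_0=0$, $U_1=1$, $U_n = PU_{n-1}-QU_{n-2}$ and $V_0=2$, $V_1=P$, $V_n = PV_{n-1}-QV_{n-2}$ for $n\ge 2$. *)

theory Defs
  imports "HOL-Analysis.Analysis"
begin

definition Li2 :: "real \<Rightarrow> real" where
  "Li2 x = (\<Sum>n. x ^ Suc n / real (Suc n) ^ 2)"

(* Only meaningful on the interval [0,1]; the values elsewhere are irrelevant. *)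
definition rogers_dilog :: "real \<Rightarrow> real" where
  "rogers_dilog x =
    (if x = 0 then 0
     else if x = 1 then pi ^ 2 / 6
     else Li2 x + 1 / 2 * ln x * ln (1 - x))"

fun lucas_U :: "real \<Rightarrow> real \<Rightarrow> nat \<Rightarrow> real" where
  "lucas_U P Q 0 = 0"
| "lucas_U P Q (Suc 0) = 1"
| "lucas_U P Q (Suc (Suc n)) = P * lucas_U P Q (Suc n) - Q * lucas_U P Q n"

fun lucas_V :: "real \<Rightarrow> real \<Rightarrow> nat \<Rightarrow> real" where
  "lucas_V P Q 0 = 2"
| "lucas_V P Q (Suc 0) = P"
| "lucas_V P Q (Suc (Suc n)) = P * lucas_V P Q (Suc n) - Q * lucas_V P Q n"

definition sums_from_1 :: "(nat \<Rightarrow> real) \<Rightarrow> real \<Rightarrow> bool" where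
  "sums_from_1 f s \<longleftrightarrow> (\<lambda>n. f (Suc n)) sums s"

end

theory Submission
  imports Defs "HOL-Real_Asymp.Real_Asymp"
begin

text \<open>
  With \<open>q = (\<beta> / \<alpha>)^k\<close>, \<open>\<beta> = P - \<alpha>\<close>, the argument of the dilogarithm in (i) is
  \<open>A n * B n\<close>, where \<open>A n = (1 - q) / (1 - q^(n+1))\<close> and \<open>B n = q^n * A n\<close>.
  Abel's five-term relation for \<open>x = A n\<close>, \<open>y = B n\<close> has \<open>A (n+1)\<close> and \<open>B (n+1)\<close> as its two
  remaining arguments, so the series telescopes; Euler's reflection formula evaluates what is left.
  In (ii) one has \<open>(\<beta> / \<alpha>)^k = - r\<close> with \<open>0 < r < 1\<close>, and the two series are the odd- and
  even-indexed parts of the series of (i) for \<open>q = r\<close>. Both functional equations hold because the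
  difference of the two sides has derivative \<open>0\<close> and vanishes at the end point \<open>0\<close>.
\<close>

section \<open>The Rogers dilogarithm on the unit interval\<close>

lemma Li2_summand_bound:
  fixes x :: real
  assumes "x \<in> {0..1}"
  shows "norm (x ^ Suc n / real (Suc n) ^ 2) \<le> 1 / real ((n + 1) ^ 2)"
proof -
  have "x ^ Suc n \<le> 1" using assms by (intro power_le_one) auto
  moreover have "x ^ Suc n \<ge> 0" using assms by simp
  ultimately show ?thesis by (simp add: divide_right_mono del: power_Suc)
qed

lemma summable_Li2:
  assumes "x \<in> {0..1}"
  shows "summable (\<lambda>n. x ^ Suc n / real (Suc n) ^ 2)"
  by (rule summable_comparison_test'[OF sums_summable[OF inverse_squares_sums]
        Li2_summand_bound[OF assms]])

text \<open>The termwise derivative below covers only the open interval. The functional equations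
  also need continuity at the end points, which uniform convergence by comparison with the inverse
  squares supplies.\<close>

lemma continuous_on_Li2: "continuous_on {0..1} Li2"
proof -
  have "uniformly_convergent_on {0..1} (\<lambda>n x. \<Sum>k<n. x ^ Suc k / real (Suc k) ^ 2)"
    by (rule Weierstrass_m_test'[OF Li2_summand_bound sums_summable[OF inverse_squares_sums]])
  then have "uniform_limit {0..1} (\<lambda>n x. \<Sum>k<n. x ^ Suc k / real (Suc k) ^ 2)
      (\<lambda>x. \<Sum>k. x ^ Suc k / real (Suc k) ^ 2) sequentially"
    by (rule uniform_limit_suminf)
  then have "continuous_on {0..1} (\<lambda>x::real. \<Sum>k. x ^ Suc k / real (Suc k) ^ 2)"
    by (rule uniform_limit_theorem[rotated])
       (auto intro!: always_eventually continuous_intros)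
  then show ?thesis by (simp add: Li2_def[abs_def])
qed

lemma Li2_0 [simp]: "Li2 0 = 0"
  by (simp add: Li2_def)

lemma Li2_1 [simp]: "Li2 1 = pi ^ 2 / 6"
  using inverse_squares_sums by (simp add: Li2_def sums_iff add.commute)

lemma suminf_power_over_Suc:
  fixes x :: real
  assumes "0 < x" "x < 1"
  shows "(\<Sum>n. x ^ n / real (Suc n)) = - ln (1 - x) / x"
proof -
  have sm: "summable (\<lambda>n. x ^ n / real (Suc n))"
    using assms
    by (intro summable_comparison_test[OF _ summable_geometric[of x]])
       (auto simp: field_simps intro!: exI[of _ 0])
  \<comment> \<open>\<open>ln_series\<close> expands the logarithm about 1, so at
    \<open>1 - x\<close> it produces powers of \<open>1 - x - 1 = - x\<close>.\<close>
  have "ln (1 - x) = (\<Sum>n. (-1)^n * (1 / real (n + 1)) * (1 - x - 1)^(Suc n))"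
    using assms by (intro ln_series) auto
  also have "(\<lambda>n. (-1)^n * (1 / real (n + 1)) * (1 - x - 1)^(Suc n))
      = (\<lambda>n. (- x) * (x ^ n / real (Suc n)))"
  proof
    fix n
    have "(-1)^n * (1 - x - 1)^(Suc n) = - x * (-1 * (1 - x - 1)) ^ n"
      by (simp only: power_mult_distrib power_Suc) (simp add: mult_ac)
    then have "(-1)^n * (1 - x - 1)^(Suc n) / real (Suc n) = - x * x ^ n / real (Suc n)"
      by simp
    then show "(-1)^n * (1 / real (n + 1)) * (1 - x - 1)^(Suc n)
        = (- x) * (x ^ n / real (Suc n))"
      by (simp del: power_Suc)
  qed
  also have "(\<Sum>n. (- x) * (x ^ n / real (Suc n))) = (- x) * (\<Sum>n. x ^ n / real (Suc n))"
    using sm by (rule suminf_mult)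
  finally show ?thesis using assms by (simp add: field_simps)
qed

lemma has_field_derivative_Li2:
  assumes "0 < x" "x < 1"
  shows "(Li2 has_real_derivative (- ln (1 - x) / x)) (at x)"
proof -
  \<comment> \<open>\<open>c 0 = 1 / 0 = 0\<close>\<close>
  define c :: "nat \<Rightarrow> real" where "c n = 1 / real n ^ 2" for n
  have sm: "summable (\<lambda>n. c n * y ^ n)" if "y \<in> {0..1}" for y
    using summable_Li2[OF that] by (subst summable_Suc_iff[symmetric]) (simp add: c_def)
  have "((\<lambda>x. \<Sum>n. c n * x ^ n) has_real_derivative (\<Sum>n. diffs c n * x ^ n)) (at x)"
    using sm[of 1] assms by (intro termdiffs_strong[of _ 1]) auto
  moreover have "(\<lambda>n. diffs c n * x ^ n) = (\<lambda>n. x ^ n / real (Suc n))"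
    by (auto simp: diffs_def c_def power2_eq_square divide_simps)
  \<comment> \<open>A derivative at \<open>x\<close> depends only on values near \<open>x\<close>,
    so agreement on the open unit interval, where the series converges, is enough.\<close>
  moreover have ev: "eventually (\<lambda>y. (\<Sum>n. c n * y ^ n) = Li2 y) (nhds x)"
  proof -
    have "eventually (\<lambda>y. y \<in> {0<..<1}) (nhds x)"
      using assms by (intro eventually_nhds_in_open) auto
    then show ?thesis
    proof eventually_elim
      case (elim y)
      then show ?case
        using suminf_split_head[OF sm[of y]] by (simp add: c_def Li2_def)
    qed
  qed
  ultimately show ?thesis
    using suminf_power_over_Suc[OF assms] DERIV_cong_ev[OF refl ev refl] by simp
qed

text \<open>The special values in the definition agree with the general formula because \<open>ln 0 = 0\<close>.\<close>

lemma rogers_dilog_eq: "rogers_dilog x = Li2 x + 1 / 2 * ln x * ln (1 - x)"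
  by (simp add: rogers_dilog_def)

lemma rogers_dilog_0 [simp]: "rogers_dilog 0 = 0"
  and rogers_dilog_1 [simp]: "rogers_dilog 1 = pi ^ 2 / 6"
  by (simp_all add: rogers_dilog_def)

text \<open>Two nonpositive logarithms have a nonnegative product. The sign is what later permits
  splitting a series by parity.\<close>

lemma rogers_dilog_nonneg:
  assumes "x \<in> {0..1}"
  shows "rogers_dilog x \<ge> 0"
proof -
  have "Li2 x \<ge> 0"
    unfolding Li2_def using summable_Li2[OF assms] assms by (intro suminf_nonneg) auto
  moreover have "ln x * ln (1 - x) \<ge> 0"
  proof (cases "x = 0 \<or> x = 1")
    case False
    then show ?thesis using assms by (intro mult_nonpos_nonpos) auto
  qed auto
  ultimately show ?thesis by (simp add: rogers_dilog_eq)
qed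

text \<open>At each end point one logarithm vanishes linearly while the other diverges only
  logarithmically, so their product tends to 0; with \<open>ln 0 = 0\<close> this is also its value
  there.\<close>

lemma continuous_on_rogers_dilog: "continuous_on {0..1} rogers_dilog"
proof -
  have "((\<lambda>x::real. ln x * ln (1 - x)) \<longlongrightarrow> ln z * ln (1 - z)) (at z within {0..1})"
    if z: "z \<in> {0..1}" for z
  proof -
    consider "z = 0" | "z = 1" | "0 < z" "z < 1" using z by (auto simp: less_le)
    then show ?thesis
    proof cases
      case 1
      have "((\<lambda>x::real. ln x * ln (1 - x)) \<longlongrightarrow> 0) (at_right 0)" by real_asymp
      then show ?thesis using 1 by (simp add: at_within_Icc_at_right)
    next
      case 2
      have "((\<lambda>x::real. ln x * ln (1 - x)) \<longlongrightarrow> 0) (at_left 1)" by real_asymp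
      then show ?thesis using 2 by (simp add: at_within_Icc_at_left)
    next
      case 3
      then show ?thesis by (auto intro!: tendsto_eq_intros)
    qed
  qed
  then have "continuous_on {0..1} (\<lambda>x::real. ln x * ln (1 - x))"
    unfolding continuous_on_def by blast
  then have "continuous_on {0..1} (\<lambda>x. Li2 x + 1 / 2 * (ln x * ln (1 - x)))"
    by (intro continuous_on_add continuous_on_mult_left continuous_on_Li2)
  then show ?thesis by (simp only: rogers_dilog_eq[abs_def] mult.assoc)
qed

lemma has_field_derivative_rogers_dilog:
  assumes "0 < x" "x < 1"
  shows "(rogers_dilog has_real_derivative (- (ln (1 - x) / x + ln x / (1 - x)) / 2)) (at x)"
  unfolding rogers_dilog_eq[abs_def]
  using assms
  by (auto intro!: derivative_eq_intros has_field_derivative_Li2 simp: field_simps)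

lemma has_field_derivative_rogers_dilog_compose [derivative_intros]:
  assumes "(f has_real_derivative f') (at x)" "0 < f x" "f x < 1"
  shows "((\<lambda>x. rogers_dilog (f x)) has_real_derivative
    (- (ln (1 - f x) / f x + ln (f x) / (1 - f x)) / 2 * f')) (at x)"
  using DERIV_chain2[OF has_field_derivative_rogers_dilog[OF assms(2,3)] assms(1)] .

lemma continuous_on_rogers_dilog_compose [continuous_intros]:
  assumes "continuous_on A f" "f ` A \<subseteq> {0..1}"
  shows "continuous_on A (\<lambda>x. rogers_dilog (f x))"
  using continuous_on_compose2[OF continuous_on_rogers_dilog assms] .

section \<open>The functional equations of Euler and Abel\<close>

text \<open>The derivative of \<open>rogers_dilog\<close> is invariant under exchanging
  \<open>x\<close> and \<open>1 - x\<close>, so the two contributions cancel.\<close>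

lemma rogers_dilog_reflection:
  assumes "x \<in> {0..1}"
  shows "rogers_dilog x + rogers_dilog (1 - x) = pi ^ 2 / 6"
proof -
  have "rogers_dilog x + rogers_dilog (1 - x) = rogers_dilog 0 + rogers_dilog (1 - 0)"
  proof (rule DERIV_isconst2[of 0 1])
    show "continuous_on {0..1} (\<lambda>x. rogers_dilog x + rogers_dilog (1 - x))"
      by (auto intro!: continuous_intros)
    show "((\<lambda>x. rogers_dilog x + rogers_dilog (1 - x)) has_real_derivative 0) (at y)"
      if "0 < y" "y < 1" for y
      using that by (auto intro!: derivative_eq_intros simp: field_simps)
  qed (use assms in auto)
  then show ?thesis by simp
qed

lemma rogers_dilog_five_term:
  assumes x: "0 < x" "x < 1" and y: "0 < y" "y < 1"
  shows "rogers_dilog x + rogers_dilog y = rogers_dilog (x * y)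
    + rogers_dilog (x * (1 - y) / (1 - x * y)) + rogers_dilog (y * (1 - x) / (1 - x * y))"
proof -
  \<comment> \<open>Here \<open>y\<close> is fixed and \<open>t\<close> varies. The constant
    \<open>rogers_dilog y\<close> is left out, so \<open>F 0 = - rogers_dilog y\<close>.\<close>
  define F where "F t = rogers_dilog t - rogers_dilog (t * y)
    - rogers_dilog (t * (1 - y) / (1 - t * y)) - rogers_dilog (y * (1 - t) / (1 - t * y))" for t
  have ty: "t * y < 1" if "t \<le> 1" for t
    using mult_right_mono[OF that, of y] y by linarith
  \<comment> \<open>Since these complements factor, every logarithm in the derivative is a
    combination of \<open>ln t\<close>, \<open>ln (1 - t)\<close>, \<open>ln y\<close>,
    \<open>ln (1 - y)\<close> and \<open>ln (1 - t * y)\<close>.\<close>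
  have cu: "1 - t * (1 - y) / (1 - t * y) = (1 - t) / (1 - t * y)"
    and cv: "1 - y * (1 - t) / (1 - t * y) = (1 - y) / (1 - t * y)" if "t \<le> 1" for t
    using ty[OF that] by (simp_all add: field_simps)
  have "F x = F 0"
  proof (rule DERIV_isconst2[of 0 1])
    have le1: "t * (1 - y) / (1 - t * y) \<le> 1" "y * (1 - t) / (1 - t * y) \<le> 1" if "t \<le> 1" for t
      using ty[OF that] that y by (simp_all add: field_simps)
    show "continuous_on {0..1} F"
    proof -
      have "t * y \<in> {0..1}" "t * (1 - y) / (1 - t * y) \<in> {0..1}"
        "y * (1 - t) / (1 - t * y) \<in> {0..1}" "1 - t * y \<noteq> 0" if "t \<in> {0..1}" for t
        using that y ty[of t] le1[of t] by auto
      then show ?thesis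
        unfolding F_def by (intro continuous_intros image_subsetI; blast)
    qed
    show "(F has_real_derivative 0) (at t)" if t: "0 < t" "t < 1" for t
    proof -
      define w where "w = 1 - t * y"
      have w: "w > 0" using ty[of t] t by (simp add: w_def)
      define u where "u = t * (1 - y) / w"
      define v where "v = y * (1 - t) / w"
      have u1: "1 - u = (1 - t) / w" and v1: "1 - v = (1 - y) / w"
        using cu[of t] cv[of t] t by (simp_all add: u_def v_def w_def)
      have pos: "0 < u" "0 < v" using t y w by (simp_all add: u_def v_def)
      have "0 < 1 - u" "0 < 1 - v" unfolding u1 v1 using t y w by simp_all
      then have lt: "u < 1" "v < 1" by simp_all
      have du: "((\<lambda>t. t * (1 - y) / (1 - t * y)) has_real_derivative (1 - y) / w ^ 2) (at t)"
        using w unfolding w_def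
        by (auto intro!: derivative_eq_intros simp: field_simps power2_eq_square)
      have dv: "((\<lambda>t. y * (1 - t) / (1 - t * y)) has_real_derivative - y * (1 - y) / w ^ 2) (at t)"
        using w unfolding w_def
        by (auto intro!: derivative_eq_intros simp: field_simps power2_eq_square)
      have lu: "ln u = ln t + ln (1 - y) - ln w" "ln (1 - u) = ln (1 - t) - ln w"
        unfolding u1 using t y w by (simp_all add: u_def ln_mult ln_div)
      have lv: "ln v = ln y + ln (1 - t) - ln w" "ln (1 - v) = ln (1 - y) - ln w"
        unfolding v1 using t y w by (simp_all add: v_def ln_mult ln_div)
      have lty: "ln (t * y) = ln t + ln y" using t y by (simp add: ln_mult)
      define L where "L z = - (ln (1 - z) / z + ln z / (1 - z)) / 2" for z :: real
      have "(F has_real_derivative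
          L t - L (t * y) * y - L u * ((1 - y) / w ^ 2) - L v * (- y * (1 - y) / w ^ 2)) (at t)"
      proof -
        note rogers = has_field_derivative_rogers_dilog_compose[folded L_def]
        have "((\<lambda>t. t * y) has_real_derivative y) (at t)"
          by (auto intro!: derivative_eq_intros)
        then have "((\<lambda>t. rogers_dilog (t * y)) has_real_derivative L (t * y) * y) (at t)"
          using t y ty[of t] by (intro rogers) auto
        moreover have "(rogers_dilog has_real_derivative L t) (at t)"
          unfolding L_def using t by (rule has_field_derivative_rogers_dilog)
        ultimately show ?thesis
          unfolding F_def using rogers[OF du] rogers[OF dv] pos lt
          by (intro DERIV_diff) (simp_all add: u_def v_def w_def)
      qed
      moreover have "L t - L (t * y) * y - L u * ((1 - y) / w ^ 2) - L v * (- y * (1 - y) / w ^ 2) = 0"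
      proof -
        define a b c d e where "a = ln t" and "b = ln (1 - t)" and "c = ln y"
          and "d = ln (1 - y)" and "e = ln w"
        \<comment> \<open>All rational coefficients are expressed through
          \<open>1 / (t * w)\<close>, \<open>y / w\<close> and
          \<open>(1 - y) / ((1 - t) * w)\<close>. This partial fraction handles
          \<open>1 / t\<close>, and \<open>**\<close> below handles
          \<open>1 / (1 - t)\<close>.\<close>
        have *: "X / t = X / (t * w) - X * y / w" for X
        proof -
          have "X / t = X * w / (t * w)" using t w by simp
          also have "X * w = X - X * y * t" by (simp add: w_def algebra_simps)
          finally show ?thesis using t by (simp add: diff_divide_distrib)
        qed
        have LTY: "L (t * y) * y = - (e / t + (a + c) * y / w) / 2"
          using t y w by (simp add: L_def lty a_def c_def e_def w_def[symmetric] field_simps)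
        have LU: "L u * ((1 - y) / w ^ 2)
            = - ((b - e) / (t * w) + (a + d - e) * (1 - y) / ((1 - t) * w)) / 2"
        proof -
          \<comment> \<open>The variables \<open>s\<close> and \<open>m\<close> stand for
            \<open>1 - y\<close> and \<open>1 - t\<close>, so that \<open>field_simps\<close> cannot
            expand these factors.\<close>
          have "- (X / (t * s / w) + Y / (m / w)) / 2 * (s / w ^ 2)
              = - (X / (t * w) + Y * s / (m * w)) / 2"
            if "s \<noteq> 0" "m \<noteq> 0" for X Y s m
            using that t w by (simp add: field_simps power2_eq_square)
          from this[of "1 - y" "1 - t"] show ?thesis
            unfolding L_def unfolding lu unfolding u1
            unfolding u_def a_def b_def d_def e_def using t y by simp
        qed
        have LV: "L v * (- y * (1 - y) / w ^ 2)
            = ((d - e) * (1 - y) / ((1 - t) * w) + (c + b - e) * y / w) / 2"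
        proof -
          have "- (X / (y * m / w) + Y / (s / w)) / 2 * (- y * s / w ^ 2)
              = (X * s / (m * w) + Y * y / w) / 2"
            if "s \<noteq> 0" "m \<noteq> 0" for X Y s m
            using that y w by (simp add: field_simps power2_eq_square)
          from this[of "1 - y" "1 - t"] show ?thesis
            unfolding L_def unfolding lv unfolding v1
            unfolding v_def b_def c_def d_def e_def using t y by simp
        qed
        have LT: "L t = - (b / t + a / (1 - t)) / 2"
          by (simp add: L_def a_def b_def)
        have **: "a / (1 - t) = a * (1 - y) / ((1 - t) * w) + a * y / w"
        proof -
          have "a / (1 - t) = a * w / ((1 - t) * w)" using t w by simp
          also have "a * w = a * (1 - y) + a * y * (1 - t)" by (simp add: w_def algebra_simps)
          finally show ?thesis using t by (simp add: add_divide_distrib)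
        qed
        \<comment> \<open>With the three fractions replaced by arbitrary \<open>i\<close>,
          \<open>j\<close>, \<open>k\<close>, the coefficient of each one cancels
          separately.\<close>
        have "- (b * i - b * j + (a * k + a * j)) / 2 - - (e * i - e * j + (a + c) * j) / 2
            - - ((b - e) * i + (a + d - e) * k) / 2 - ((d - e) * k + (c + b - e) * j) / 2 = 0" for i j k
          by (simp add: field_simps)
        from this[of "1 / (t * w)" "y / w" "(1 - y) / ((1 - t) * w)"] show ?thesis
          unfolding LT LTY LU LV ** *[of b] *[of e] unfolding times_divide_eq_right mult_1_right .
      qed
      ultimately show ?thesis by simp
    qed
  qed (use x in auto)
  then show ?thesis by (simp add: F_def)
qed

section \<open>The telescoping series\<close>

lemma rogers_dilog_sums:
  fixes q :: real
  assumes q: "0 < q" "q < 1"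
  shows "(\<lambda>n. rogers_dilog ((1 - q) ^ 2 * q ^ Suc n / (1 - q ^ Suc (Suc n)) ^ 2)) sums rogers_dilog q"
proof -
  define A where "A n = (1 - q) / (1 - q ^ Suc n)" for n
  define B where "B n = q ^ n * A n" for n
  define f where "f n = rogers_dilog (A n) + rogers_dilog (B n)" for n
  have qn: "0 < q ^ n" "q ^ n \<le> 1" "q ^ Suc n < 1" for n
    using q power_Suc_less_one[of q n] by (auto intro: power_le_one)
  \<comment> \<open>The index 0 is excluded because \<open>A 0 = B 0 = 1\<close> is outside the
    range of the five-term relation.\<close>
  have step: "rogers_dilog ((1 - q) ^ 2 * q ^ n / (1 - q ^ Suc n) ^ 2) = f n - f (Suc n)"
    if n: "n > 0" for n
  proof -
    define p where "p = q ^ n"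
    have p: "0 < p" "p < 1" using qn[of "n - 1"] qn[of n] n by (auto simp: p_def)
    have qp: "q * p < 1" "q * (q * p) < 1" using qn(3)[of n] qn(3)[of "Suc n"] by (auto simp: p_def)
    have An: "A n = (1 - q) / (1 - q * p)" and Bn: "B n = p * (1 - q) / (1 - q * p)"
      and AS: "A (Suc n) = (1 - q) / (1 - q * (q * p))"
      and BS: "B (Suc n) = q * p * (1 - q) / (1 - q * (q * p))"
      by (simp_all add: A_def B_def p_def)
    have A1: "1 - A n = q * (1 - p) / (1 - q * p)" and B1: "1 - B n = (1 - p) / (1 - q * p)"
      unfolding An Bn using qp by (simp_all add: field_simps)
    \<comment> \<open>The factor \<open>1 - p\<close> cancels against the one in
      \<open>1 - A n\<close> or \<open>1 - B n\<close>, and the other factor is the denominator of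
      \<open>A (Suc n)\<close> and \<open>B (Suc n)\<close>.\<close>
    have AB: "1 - A n * B n = (1 - p) * (1 - q * (q * p)) / (1 - q * p) ^ 2"
      unfolding An Bn using qp by (simp add: divide_simps power2_eq_square) algebra
    have pos: "0 < A n" "0 < B n" "0 < 1 - A n" "0 < 1 - B n"
      unfolding A1 B1 unfolding An Bn using qp p q by simp_all
    have cancel: "x / s * (y * t / s) / (t * w / s ^ 2) = x * y / w"
      if "s \<noteq> 0" "t \<noteq> 0" for x y s t w :: real
      using that by (simp add: power2_eq_square)
    have "A n * (1 - B n) / (1 - A n * B n) = A (Suc n)"
      unfolding AB B1 unfolding An AS
      using cancel[of "1 - q * p" "1 - p" "1 - q" 1] qp p by simp
    moreover have "B n * (1 - A n) / (1 - A n * B n) = B (Suc n)"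
      unfolding AB A1 unfolding Bn BS
      using cancel[of "1 - q * p" "1 - p" "p * (1 - q)" q "1 - q * (q * p)"] qp p
      by (simp only: mult_ac)
    moreover have "A n * B n = (1 - q) ^ 2 * q ^ n / (1 - q ^ Suc n) ^ 2"
      by (simp add: A_def B_def power2_eq_square)
    ultimately show ?thesis
      using rogers_dilog_five_term[of "A n" "B n"] pos by (simp add: f_def)
  qed
  have Alim: "A \<longlonglongrightarrow> 1 - q"
  proof -
    have "(\<lambda>n. q ^ Suc n) \<longlonglongrightarrow> 0"
      using q by (intro LIMSEQ_Suc LIMSEQ_power_zero) auto
    then have "A \<longlonglongrightarrow> (1 - q) / (1 - 0)"
      unfolding A_def by (intro tendsto_intros) auto
    then show ?thesis by simp
  qed
  have Blim: "B \<longlonglongrightarrow> 0"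
  proof -
    have "B \<longlonglongrightarrow> 0 * (1 - q)"
      unfolding B_def using q by (intro tendsto_mult Alim LIMSEQ_power_zero) auto
    then show ?thesis by simp
  qed
  have A01: "A n \<in> {0..1}" for n
  proof -
    have "q * q ^ n \<le> q * 1" using q qn[of n] by (intro mult_left_mono) auto
    then show ?thesis using q qn[of n] by (simp add: A_def)
  qed
  have B01: "B n \<in> {0..1}" for n
    using A01[of n] qn[of n] by (auto simp: B_def intro!: mult_le_one)
  have cont: "(\<lambda>n. rogers_dilog (X n)) \<longlonglongrightarrow> rogers_dilog l"
    if "X \<longlonglongrightarrow> l" "\<And>n. X n \<in> {0..1}" "l \<in> {0..1}" for X :: "nat \<Rightarrow> real" and l
    using continuous_on_tendsto_compose[OF continuous_on_rogers_dilog that(1) that(3)] that(2)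
    by auto
  have "f \<longlonglongrightarrow> rogers_dilog (1 - q) + rogers_dilog 0"
    unfolding f_def using A01 B01 q by (intro tendsto_add cont Alim Blim) auto
  then have "(\<lambda>n. f (Suc n)) \<longlonglongrightarrow> rogers_dilog (1 - q)"
    by (intro LIMSEQ_Suc) simp
  from telescope_sums'[OF this]
  have "(\<lambda>n. f (Suc n) - f (Suc (Suc n))) sums (f (Suc 0) - rogers_dilog (1 - q))" .
  \<comment> \<open>The first pair is complementary, \<open>A 1 + B 1 = 1\<close>, so reflection
    evaluates it.\<close>
  moreover have "f (Suc 0) = pi ^ 2 / 6"
  proof -
    have "1 - q * q = (1 - q) * (1 + q)" by algebra
    then have "A 1 = 1 / (1 + q)" using q by (simp add: A_def)
    moreover have "B 1 = 1 - 1 / (1 + q)" using q calculation by (simp add: B_def field_simps)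
    ultimately show ?thesis
      using rogers_dilog_reflection[of "1 / (1 + q)"] q by (simp add: f_def)
  qed
  moreover have "pi ^ 2 / 6 - rogers_dilog (1 - q) = rogers_dilog q"
    using rogers_dilog_reflection[of q] q by simp
  moreover have "rogers_dilog ((1 - q) ^ 2 * q ^ Suc n / (1 - q ^ Suc (Suc n)) ^ 2)
      = f (Suc n) - f (Suc (Suc n))" for n
    using step[of "Suc n"] by simp
  ultimately show ?thesis by simp
qed

text \<open>The denominator is at least \<open>(1 - q) ^ 2\<close> because \<open>q ^ Suc n\<close>
  is at most \<open>q\<close>. This makes \<open>rogers_dilog_nonneg\<close> applicable to the
  terms.\<close>

lemma telescoping_argument_in_unit_interval:
  fixes q :: real
  assumes q: "0 < q" "q < 1"
  shows "(1 - q) ^ 2 * q ^ n / (1 - q ^ Suc n) ^ 2 \<in> {0..1}"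
proof -
  have "q ^ n \<le> 1" using q by (intro power_le_one) auto
  then have "q * q ^ n \<le> q" using q by (simp add: mult_left_le)
  then have "(1 - q) ^ 2 \<le> (1 - q ^ Suc n) ^ 2" using q by (intro power_mono) auto
  moreover have "(1 - q) ^ 2 * q ^ n \<le> (1 - q) ^ 2 * 1"
    using \<open>q ^ n \<le> 1\<close> by (intro mult_left_mono) auto
  ultimately have "(1 - q) ^ 2 * q ^ n \<le> (1 - q ^ Suc n) ^ 2" by simp
  then show ?thesis using q by (auto simp: divide_le_eq_1 simp del: power_Suc)
qed

text \<open>Grouping terms in pairs keeps the sum; by nonnegativity the paired series dominates the
  even part, which therefore converges, and the odd part is the difference.\<close>

lemma sums_even_odd_split:
  fixes f :: "nat \<Rightarrow> real"
  assumes "f sums s" "\<And>n. f n \<ge> 0"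
  obtains S T where "(\<lambda>n. f (2 * n)) sums S" "(\<lambda>n. f (Suc (2 * n))) sums T" "S + T = s"
proof -
  have *: "(\<lambda>n. f (2 * n) + f (Suc (2 * n))) sums s"
    using sums_group[OF assms(1), of 2] by (simp add: mult.commute numeral_2_eq_2)
  have "summable (\<lambda>n. f (2 * n))"
    by (rule summable_comparison_test[OF _ sums_summable[OF *]]) (auto simp: assms(2))
  then obtain S where S: "(\<lambda>n. f (2 * n)) sums S" by (auto simp: summable_def)
  from sums_diff[OF * S] have "(\<lambda>n. f (Suc (2 * n))) sums (s - S)" by simp
  with S show thesis by (intro that[of S "s - S"]) auto
qed

section \<open>Lucas sequences\<close>

text \<open>The parameters are written as sum and product of the characteristic roots, and the
  factor \<open>a - b\<close> avoids a division.\<close>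

lemma lucas_U_binet:
  fixes a b :: real
  shows "(a - b) * lucas_U (a + b) (a * b) n = a ^ n - b ^ n"
proof (induction n rule: induct_nat_012)
  case (ge2 n)
  have "(a - b) * lucas_U (a + b) (a * b) (Suc (Suc n))
      = (a + b) * ((a - b) * lucas_U (a + b) (a * b) (Suc n))
        - a * b * ((a - b) * lucas_U (a + b) (a * b) n)"
    by (simp add: algebra_simps)
  then show ?case unfolding ge2 by (simp add: algebra_simps)
qed auto

lemma lucas_V_binet:
  fixes a b :: real
  shows "lucas_V (a + b) (a * b) n = a ^ n + b ^ n"
proof (induction n rule: induct_nat_012)
  case (ge2 n)
  then show ?case by (simp add: algebra_simps)
qed auto

text \<open>By homogeneity \<open>(a ^ Suc n) ^ 2\<close> splits off from numerator and denominator.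
  In the application \<open>a\<close> is the \<open>k\<close>-th power of \<alpha>, and
  \<open>c * a\<close> is that of \<beta> up to sign.\<close>

lemma power_difference_ratio:
  fixes a c :: real
  assumes "a \<noteq> 0"
  shows "(a - c * a) ^ 2 * (c * a ^ 2) ^ n / (a ^ Suc n - (c * a) ^ Suc n) ^ 2
    = (1 - c) ^ 2 * c ^ n / (1 - c ^ Suc n) ^ 2"
proof -
  have "(a - c * a) ^ 2 * (c * a ^ 2) ^ n = (a ^ Suc n) ^ 2 * ((1 - c) ^ 2 * c ^ n)"
    by (simp add: power_mult_distrib power2_eq_square algebra_simps)
  moreover have "(a ^ Suc n - (c * a) ^ Suc n) ^ 2 = (a ^ Suc n) ^ 2 * (1 - c ^ Suc n) ^ 2"
    by (simp add: power_mult_distrib power2_eq_square algebra_simps)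
  ultimately show ?thesis using assms by simp
qed

section \<open>The two summation formulas\<close>

theorem theorem5:
  fixes P Q D \<alpha> :: real
  assumes "P > 0" and "Q \<noteq> 0"
    and "D = P ^ 2 - 4 * Q" and "D > 0"
    and "\<alpha> = (P + sqrt D) / 2"
  shows "(Q > 0 \<longrightarrow> (\<forall>k::nat. k > 0 \<longrightarrow>
            sums_from_1
              (\<lambda>n. rogers_dilog
                 ((lucas_U P Q k) ^ 2 * Q ^ (k * n) / (lucas_U P Q (k * (n + 1))) ^ 2))
              (rogers_dilog (Q ^ k / \<alpha> ^ (2 * k)))))
       \<and> (Q < 0 \<longrightarrow> (\<forall>k::nat. k > 0 \<and> odd k \<longrightarrow>
            (\<exists>S T.
              sums_from_1
                (\<lambda>n. rogers_dilog
                   (- ((lucas_V P Q k) ^ 2 * Q ^ (k * (2 * n - 1))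
                       / (D * (lucas_U P Q (2 * k * n)) ^ 2)))) S
              \<and> sums_from_1
                (\<lambda>n. rogers_dilog
                   ((lucas_V P Q k) ^ 2 * Q ^ (2 * k * n)
                       / (lucas_V P Q (k * (2 * n + 1))) ^ 2)) T
              \<and> S + T = rogers_dilog (- (Q ^ k / \<alpha> ^ (2 * k))))))"
proof -
  define \<beta> where "\<beta> = P - \<alpha>"
  have "sqrt D > 0" using assms(4) by (simp only: real_sqrt_gt_0_iff)
  have "\<alpha> > 0" using add_pos_pos[OF assms(1) \<open>sqrt D > 0\<close>] by (simp add: assms(5))
  have diff: "\<alpha> - \<beta> = sqrt D" by (simp add: \<beta>_def assms(5))
  have P: "P = \<alpha> + \<beta>" by (simp add: \<beta>_def)
  have "(\<alpha> - \<beta>) ^ 2 = D" using diff assms(4) by simp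
  then have Q: "Q = \<alpha> * \<beta>" using assms(3) by (simp add: P power2_eq_square algebra_simps)
  have D: "D = (\<alpha> - \<beta>) ^ 2" using \<open>(\<alpha> - \<beta>) ^ 2 = D\<close> ..
  have U: "lucas_U P Q n = (\<alpha> ^ n - \<beta> ^ n) / (\<alpha> - \<beta>)" for n
    using lucas_U_binet[of \<alpha> \<beta> n] diff \<open>sqrt D > 0\<close> unfolding P Q by (simp add: field_simps)
  have V: "lucas_V P Q n = \<alpha> ^ n + \<beta> ^ n" for n
    unfolding P Q by (rule lucas_V_binet)
  \<comment> \<open>The first bound comes from \<open>D > 0\<close> and gives \<open>q < 1\<close>
    in (i); the second comes from \<open>P > 0\<close> and gives \<open>r < 1\<close> in
    (ii).\<close>
  have "\<beta> < \<alpha>" "- \<beta> < \<alpha>" using diff \<open>sqrt D > 0\<close> assms(1) P by linarith+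

  have part1: "sums_from_1
      (\<lambda>n. rogers_dilog
         ((lucas_U P Q k) ^ 2 * Q ^ (k * n) / (lucas_U P Q (k * (n + 1))) ^ 2))
      (rogers_dilog (Q ^ k / \<alpha> ^ (2 * k)))"
    if "Q > 0" "k > 0" for k
  proof -
    define a where "a = \<alpha> ^ k"
    define q where "q = \<beta> ^ k / \<alpha> ^ k"
    have "\<beta> > 0" using \<open>Q > 0\<close> \<open>\<alpha> > 0\<close> Q by (simp add: zero_less_mult_iff)
    then have q: "0 < q" "q < 1"
      using \<open>\<beta> < \<alpha>\<close> \<open>\<alpha> > 0\<close> \<open>k > 0\<close> by (simp_all add: q_def power_strict_mono)
    have a: "a \<noteq> 0" using \<open>\<alpha> > 0\<close> by (simp add: a_def)
    have b: "\<beta> ^ k = q * a" using a by (simp add: q_def a_def)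
    have Qk: "Q ^ k = q * a ^ 2"
      by (simp add: Q power_mult_distrib b power2_eq_square flip: a_def)
    have Uk: "lucas_U P Q (k * n) = (a ^ n - (q * a) ^ n) / (\<alpha> - \<beta>)" for n
      by (simp add: U power_mult b flip: a_def)
    have "lucas_U P Q k ^ 2 * Q ^ (k * n) / lucas_U P Q (k * (n + 1)) ^ 2
        = (1 - q) ^ 2 * q ^ n / (1 - q ^ Suc n) ^ 2" for n
    proof -
      have "lucas_U P Q k ^ 2 * Q ^ (k * n) / lucas_U P Q (k * (n + 1)) ^ 2
          = (a - q * a) ^ 2 * (q * a ^ 2) ^ n / (a ^ Suc n - (q * a) ^ Suc n) ^ 2"
        using Uk[of 1] Uk[of "n + 1"] \<open>\<beta> < \<alpha>\<close>
        by (simp add: power_mult Qk power_divide del: power_Suc)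
      then show ?thesis using power_difference_ratio[OF a] by simp
    qed
    moreover have "Q ^ k / \<alpha> ^ (2 * k) = q"
      using a by (simp add: Qk mult.commute[of 2] power_mult flip: a_def)
    ultimately show ?thesis
      using rogers_dilog_sums[OF q] by (simp add: sums_from_1_def)
  qed

  have part2: "\<exists>S T.
      sums_from_1
        (\<lambda>n. rogers_dilog
           (- ((lucas_V P Q k) ^ 2 * Q ^ (k * (2 * n - 1))
               / (D * (lucas_U P Q (2 * k * n)) ^ 2)))) S
      \<and> sums_from_1
        (\<lambda>n. rogers_dilog
           ((lucas_V P Q k) ^ 2 * Q ^ (2 * k * n)
               / (lucas_V P Q (k * (2 * n + 1))) ^ 2)) T
      \<and> S + T = rogers_dilog (- (Q ^ k / \<alpha> ^ (2 * k)))"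
    if "Q < 0" "k > 0" "odd k" for k
  proof -
    define a where "a = \<alpha> ^ k"
    define r where "r = (- \<beta>) ^ k / \<alpha> ^ k"
    have "\<beta> < 0" using \<open>Q < 0\<close> \<open>\<alpha> > 0\<close> Q by (simp add: mult_less_0_iff)
    then have r: "0 < r" "r < 1"
      using \<open>- \<beta> < \<alpha>\<close> \<open>\<alpha> > 0\<close> \<open>k > 0\<close> by (auto simp: r_def power_strict_mono simp del: power_minus_odd)
    have a: "a \<noteq> 0" using \<open>\<alpha> > 0\<close> by (simp add: a_def)
    \<comment> \<open>Oddness of \<open>k\<close> brings in the minus sign, which turns the sum in
      Binet's formula for \<open>lucas_V P Q k\<close> into the difference
      \<open>a - r * a\<close>.\<close>
    have b: "\<beta> ^ k = - (r * a)" using a \<open>odd k\<close> by (simp add: r_def a_def)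
    have Qk: "Q ^ k = - (r * a ^ 2)"
      by (simp add: Q power_mult_distrib b power2_eq_square flip: a_def)
    \<comment> \<open>Counting starts at 0 here, so the first series of (ii) collects
      \<open>z 0\<close>, \<open>z 2\<close>, ... and the second \<open>z 1\<close>,
      \<open>z 3\<close>, ...\<close>
    define z where "z n = (1 - r) ^ 2 * r ^ Suc n / (1 - r ^ Suc (Suc n)) ^ 2" for n
    have z: "z n = (a - r * a) ^ 2 * (r * a ^ 2) ^ Suc n / (a ^ Suc (Suc n) - (r * a) ^ Suc (Suc n)) ^ 2"
      for n unfolding z_def by (rule power_difference_ratio[OF a, symmetric])
    have Vk: "lucas_V P Q k = a - r * a"
      by (simp add: V b flip: a_def)
    have odd_term: "- ((lucas_V P Q k) ^ 2 * Q ^ (k * (2 * Suc n - 1))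
        / (D * (lucas_U P Q (2 * k * Suc n)) ^ 2)) = z (2 * n)" for n
    proof -
      have Q_pow: "Q ^ (k * (2 * Suc n - 1)) = - ((r * a ^ 2) ^ Suc (2 * n))"
        unfolding power_mult Qk by simp
      \<comment> \<open>\<open>D\<close> cancels the squared denominator of Binet's formula, and the
        even exponent removes the sign of \<open>- (r * a)\<close>.\<close>
      have D_U: "D * (lucas_U P Q (k * Suc (Suc (2 * n)))) ^ 2
          = (a ^ Suc (Suc (2 * n)) - (r * a) ^ Suc (Suc (2 * n))) ^ 2"
        using \<open>\<beta> < \<alpha>\<close> unfolding U D power_mult[of _ k] b a_def[symmetric]
        by (simp add: power_divide)
      have idx: "2 * k * Suc n = k * Suc (Suc (2 * n))" by simp
      show ?thesis unfolding idx Q_pow D_U z Vk by simp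
    qed
    have even_term: "(lucas_V P Q k) ^ 2 * Q ^ (2 * k * Suc n)
        / (lucas_V P Q (k * (2 * Suc n + 1))) ^ 2 = z (Suc (2 * n))" for n
    proof -
      have "2 * k * Suc n = k * Suc (Suc (2 * n))" by simp
      then have "Q ^ (2 * k * Suc n) = (r * a ^ 2) ^ Suc (Suc (2 * n))"
        by (simp only: power_mult Qk) simp
      \<comment> \<open>The exponent is odd this time, so the sign survives and the sum of powers
        becomes a difference.\<close>
      moreover have "lucas_V P Q (k * (2 * Suc n + 1))
          = a ^ Suc (Suc (Suc (2 * n))) - (r * a) ^ Suc (Suc (Suc (2 * n)))"
        unfolding V power_mult[of _ k] b a_def[symmetric] by simp
      ultimately show ?thesis unfolding z Vk by simp
    qed
    have "(\<lambda>n. rogers_dilog (z n)) sums rogers_dilog r"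
      unfolding z_def by (rule rogers_dilog_sums[OF r])
    moreover have "rogers_dilog (z n) \<ge> 0" for n
      unfolding z_def by (intro rogers_dilog_nonneg telescoping_argument_in_unit_interval r)
    ultimately obtain S T where "(\<lambda>n. rogers_dilog (z (2 * n))) sums S"
      "(\<lambda>n. rogers_dilog (z (Suc (2 * n)))) sums T" "S + T = rogers_dilog r"
      by (rule sums_even_odd_split)
    moreover have "- (Q ^ k / \<alpha> ^ (2 * k)) = r"
      using a by (simp add: Qk mult.commute[of 2] power_mult flip: a_def)
    ultimately show ?thesis
      unfolding sums_from_1_def odd_term even_term by auto
  qed

  show ?thesis using part1 part2 by blast
qed

end
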